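(* The following properties are equivalent: 1) each graph with conditions has an $\omega$-unfriendly partition; 2) each graph has an $\omega$-unfriendly partition; 3) each countable graph has an unfriendly partition; 4) each countable graph without nonempty induced subgraph of infinite minimum degree has an unfriendly partition.
   Context: A graph is a pair $G=(V,E)$ where $V$ is the set of vertices and $E$ is the set of edges; edges are unordered pairs $\{x,y\}$ with $x,y\in V$, $x\neq y$. Graphs may be infinite of any cardinality. The induced (sub)graphs of $G$ are the graphs $H=(W,F)$ with $W\subset V$ and $F=\{\{x,y\}\in E\mid x,y\in W\}$. The neighbours of $x$ are the vertices $y$ with $\{x,y\}\in E$; the degree of $x$ is the cardinal of its set of neighbours; the minimum degree of a graph is the minimum of the degrees of its vertices. Here $\omega=\aleph_0$. Graphs (without conditions). A partition of $G$ is a map $\pi:V\to\{0,1\}$. For $x\in V$ write $d_{\neq}(x)=|\{y\in V\mid\{x,y\}\in E\text{ and }\pi(y)\neq\pi(x)\}|$ and $d_{=}(x)=|\{y\in V\mid\{x,y\}\in E\text{ and }\pi(y)=\pi(x)\}|$ (cardinals, possibly infinite). The partition $\pi$ is unfriendly if $d_{\neq}(x)\geq d_{=}(x)$ for each $x\in V$. For a cardinal $\kappa$, $\pi$ is $\kappa$-unfriendly if, for each $x\in V$, $d_{\neq}(x)\geq\kappa$ or $d_{\neq}(x)\geq d_{=}(x)$. Graphs with conditions. A graph with conditions is a pair $\Gamma=(G,\mathcal{C})$ where $G=(V,E)$ is a graph and $\mathcal{C}=(\kappa_x,\lambda_x)_{x\in V}$ with $\kappa_x,\lambda_x$ finite or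 infinite cardinals for each $x\in V$. For a map $\pi:V\to\{0,1\}$ and $x\in V$, put $a_x=\kappa_x+|\{y\in V\mid\{x,y\}\in E\text{ and }\pi(y)=0\}|$ and $b_x=\lambda_x+|\{y\in V\mid\{x,y\}\in E\text{ and }\pi(y)=1\}|$. For a cardinal $\mu$, $\pi$ is a $\mu$-unfriendly partition of $\Gamma$ if for each $x\in V$ the two implications "$\pi(x)=0$ implies $a_x\leq b_x$" and "$\pi(x)=1$ implies $a_x\geq b_x$" are true, except possibly when the two cardinals $a_x,b_x$ are both $\geq\mu$. *)

theory Defs
  imports "HOL-Library.FuncSet" "HOL-Library.Countable_Set"
begin

unbundle cardinal_syntax

text \<open>
  Cardinals are the cardinal orders of the library, compared with \<open>\<le>o\<close>, which relates cardinals
  over different types; \<open>natLeq\<close> is \<open>\<omega>\<close>.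
\<close>

definition is_graph :: "'a set \<Rightarrow> 'a set set \<Rightarrow> bool" where
  "is_graph V E \<longleftrightarrow> (\<forall>e\<in>E. \<exists>x\<in>V. \<exists>y\<in>V. x \<noteq> y \<and> e = {x, y})"

definition induced_subgraph :: "'a set \<Rightarrow> 'a set set \<Rightarrow> 'a set \<Rightarrow> 'a set set \<Rightarrow> bool" where
  "induced_subgraph W F V E \<longleftrightarrow>
     W \<subseteq> V \<and> F = {e. \<exists>x y. e = {x, y} \<and> {x, y} \<in> E \<and> x \<in> W \<and> y \<in> W}"

definition neighbours :: "'a set \<Rightarrow> 'a set set \<Rightarrow> 'a \<Rightarrow> 'a set" where
  "neighbours V E x = {y \<in> V. {x, y} \<in> E}"

definition degree :: "'a set \<Rightarrow> 'a set set \<Rightarrow> 'a \<Rightarrow> 'a rel" where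
  "degree V E x = |neighbours V E x|"

text \<open>
  The degree of a vertex at which it is smallest; by \<open>min_degree_minimum\<close> such a vertex exists
  as soon as \<open>V \<noteq> {}\<close>, and for \<open>V = {}\<close> the value is arbitrary.
\<close>
definition min_degree :: "'a set \<Rightarrow> 'a set set \<Rightarrow> 'a rel" where
  "min_degree V E = degree V E (SOME x. x \<in> V \<and> (\<forall>y\<in>V. degree V E x \<le>o degree V E y))"

lemma min_degree_minimum:
  assumes "V \<noteq> {}"
  shows "\<exists>x\<in>V. min_degree V E = degree V E x"
    and "\<forall>y\<in>V. min_degree V E \<le>o degree V E y"
proof -
  have "\<exists>r \<in> degree V E ` V. \<forall>r' \<in> degree V E ` V. r \<le>o r'"
    using assms by (intro exists_minim_Card_order) (auto simp: degree_def intro: card_of_Card_order)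
  then have "\<exists>x. x \<in> V \<and> (\<forall>y\<in>V. degree V E x \<le>o degree V E y)"
    by blast
  from someI_ex[OF this]
  show "\<exists>x\<in>V. min_degree V E = degree V E x" "\<forall>y\<in>V. min_degree V E \<le>o degree V E y"
    unfolding min_degree_def by blast+
qed

text \<open>Partitions: only the values of \<open>\<pi>\<close> on \<open>V\<close> are relevant.\<close>

definition is_partition :: "'a set \<Rightarrow> ('a \<Rightarrow> nat) \<Rightarrow> bool" where
  "is_partition V \<pi> \<longleftrightarrow> \<pi> \<in> V \<rightarrow> {0, 1}"

definition d_neq :: "'a set \<Rightarrow> 'a set set \<Rightarrow> ('a \<Rightarrow> nat) \<Rightarrow> 'a \<Rightarrow> 'a rel" where
  "d_neq V E \<pi> x = |{y \<in> V. {x, y} \<in> E \<and> \<pi> y \<noteq> \<pi> x}|"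

definition d_eq :: "'a set \<Rightarrow> 'a set set \<Rightarrow> ('a \<Rightarrow> nat) \<Rightarrow> 'a \<Rightarrow> 'a rel" where
  "d_eq V E \<pi> x = |{y \<in> V. {x, y} \<in> E \<and> \<pi> y = \<pi> x}|"

definition unfriendly :: "'a set \<Rightarrow> 'a set set \<Rightarrow> ('a \<Rightarrow> nat) \<Rightarrow> bool" where
  "unfriendly V E \<pi> \<longleftrightarrow>
     is_partition V \<pi> \<and> (\<forall>x\<in>V. d_eq V E \<pi> x \<le>o d_neq V E \<pi> x)"

definition card_unfriendly ::
    "'m rel \<Rightarrow> 'a set \<Rightarrow> 'a set set \<Rightarrow> ('a \<Rightarrow> nat) \<Rightarrow> bool" where
  "card_unfriendly \<mu> V E \<pi> \<longleftrightarrow>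
     is_partition V \<pi> \<and>
     (\<forall>x\<in>V. \<mu> \<le>o d_neq V E \<pi> x \<or> d_eq V E \<pi> x \<le>o d_neq V E \<pi> x)"

definition is_conditioned_graph ::
    "'a set \<Rightarrow> 'a set set \<Rightarrow> ('a \<Rightarrow> 'k rel) \<Rightarrow> ('a \<Rightarrow> 'k rel) \<Rightarrow> bool" where
  "is_conditioned_graph V E \<kappa> \<nu> \<longleftrightarrow>
     is_graph V E \<and> (\<forall>x\<in>V. Card_order (\<kappa> x) \<and> Card_order (\<nu> x))"

text \<open>
  The cardinals \<open>a\<^sub>x\<close> (for \<open>i = 0\<close>, \<open>c = \<kappa>\<close>) and \<open>b\<^sub>x\<close> (for \<open>i = 1\<close>, \<open>c = \<nu>\<close>); here \<open>\<nu>\<close>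
  stands for the family usually written \<open>\<lambda>\<close>, which is reserved syntax.
\<close>
definition cond_degree ::
    "'a set \<Rightarrow> 'a set set \<Rightarrow> ('a \<Rightarrow> 'k rel) \<Rightarrow> ('a \<Rightarrow> nat) \<Rightarrow> nat \<Rightarrow> 'a \<Rightarrow> ('k + 'a) rel" where
  "cond_degree V E c \<pi> i x = c x +c |{y \<in> V. {x, y} \<in> E \<and> \<pi> y = i}|"

definition cond_unfriendly ::
    "'m rel \<Rightarrow> 'a set \<Rightarrow> 'a set set \<Rightarrow> ('a \<Rightarrow> 'k rel) \<Rightarrow> ('a \<Rightarrow> 'k rel) \<Rightarrow> ('a \<Rightarrow> nat) \<Rightarrow> bool" where
  "cond_unfriendly \<mu> V E \<kappa> \<nu> \<pi> \<longleftrightarrow>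
     is_partition V \<pi> \<and>
     (\<forall>x\<in>V.
        let a = cond_degree V E \<kappa> \<pi> 0 x; b = cond_degree V E \<nu> \<pi> 1 x
        in ((\<pi> x = 0 \<longrightarrow> a \<le>o b) \<and> (\<pi> x = 1 \<longrightarrow> b \<le>o a)) \<or> (\<mu> \<le>o a \<and> \<mu> \<le>o b))"

text \<open>
  The four properties, for graphs whose vertices are elements of the type \<open>'a\<close> and, in the first
  one, conditions that are cardinals over the type \<open>'k\<close>.
\<close>

definition conditioned_graphs_omega_unfriendly :: "'a itself \<Rightarrow> 'k itself \<Rightarrow> bool" where
  "conditioned_graphs_omega_unfriendly _ _ \<longleftrightarrow>
     (\<forall>(V :: 'a set) E (\<kappa> :: 'a \<Rightarrow> 'k rel) \<nu>.
        is_conditioned_graph V E \<kappa> \<nu> \<longrightarrow> (\<exists>\<pi>. cond_unfriendly natLeq V E \<kappa> \<nu> \<pi>))"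

definition graphs_omega_unfriendly :: "'a itself \<Rightarrow> bool" where
  "graphs_omega_unfriendly _ \<longleftrightarrow>
     (\<forall>(V :: 'a set) E. is_graph V E \<longrightarrow> (\<exists>\<pi>. card_unfriendly natLeq V E \<pi>))"

definition countable_graphs_unfriendly :: "'a itself \<Rightarrow> bool" where
  "countable_graphs_unfriendly _ \<longleftrightarrow>
     (\<forall>(V :: 'a set) E. is_graph V E \<and> countable V \<longrightarrow> (\<exists>\<pi>. unfriendly V E \<pi>))"

definition restricted_countable_graphs_unfriendly :: "'a itself \<Rightarrow> bool" where
  "restricted_countable_graphs_unfriendly _ \<longleftrightarrow>
     (\<forall>(V :: 'a set) E.
        is_graph V E \<and> countable V \<and>
        \<not> (\<exists>W F. induced_subgraph W F V E \<and> W \<noteq> {} \<and> cinfinite (min_degree W F)) \<longrightarrow>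
        (\<exists>\<pi>. unfriendly V E \<pi>))"

end

theory Submission
  imports Defs "HOL-Library.Extended_Nat" "HOL-Library.Nat_Bijection" "HOL-Library.Disjoint_Sets"
    "HOL-Library.Countable_Set_Type"
begin

text \<open>
  Three implications are immediate: graphs are graphs with zero conditions, in a countable graph \<open>\<omega>\<close> is the
  only possible infinite degree, and the fourth property restricts the third one. The theorem is therefore
  that the fourth property yields an \<open>\<omega>\<close>-unfriendly partition of each graph with conditions, of any
  cardinality. Since \<open>\<omega>\<close>-unfriendliness does not distinguish infinite cardinals, all counts are taken
  in the extended natural numbers (\<open>ecard_le_iff\<close>).

  Conditions on a countable graph without core, where a core is an induced subgraph of infinite
  minimum degree, are simulated by attaching the graph to a locally finite graph that has only one
  unfriendly partition up to swapping the colours (\<open>layers_alternate\<close>). Finite layers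
  completely joined to their successors, with growing sizes, have this rigidity, even if one vertex of
  each layer gets one extra edge. They offer infinitely many vertices of each colour to attach to,
  and they bring no new core, so the fourth property applies to the combined graph
  (\<open>countable_conditioned_colouring\<close>).

  For an arbitrary graph, Zorn's lemma provides a maximal partial partition all of whose
  vertices are satisfied once and for all, because they have infinitely many opposite neighbours or
  no uncoloured neighbours. If a vertex were left over, it would lie in a countable hull whose vertices
  have infinitely many neighbours in the hull or all their uncoloured neighbours there. Either the hull
  contains a core, and a set splitting all its neighbourhoods into two infinite parts colours
  this core; or it contains none, and can be coloured with the coloured neighbours taken as
  conditions. Both contradict maximality (\<open>unfriendly_colouring_if_countable\<close>).
\<close>

section \<open>Cardinalities with a single infinite value\<close>

definition ecard :: "'a set \<Rightarrow> enat" where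
  "ecard A = (if finite A then enat (card A) else \<infinity>)"

lemma ecard_eq_infinity_iff [simp]: "ecard A = \<infinity> \<longleftrightarrow> infinite A"
  by (simp add: ecard_def)

lemma ecard_empty [simp]: "ecard {} = 0"
  by (simp add: ecard_def zero_enat_def)

lemma ecard_mono: "A \<subseteq> B \<Longrightarrow> ecard A \<le> ecard B"
  by (auto simp: ecard_def card_mono finite_subset)

lemma ecard_Un_disjoint: "A \<inter> B = {} \<Longrightarrow> ecard (A \<union> B) = ecard A + ecard B"
  by (auto simp: ecard_def card_Un_disjoint)

lemma ecard_image: "inj_on f A \<Longrightarrow> ecard (f ` A) = ecard A"
  by (auto simp: ecard_def card_image finite_image_iff)

lemma ecard_Plus: "ecard (A <+> B) = ecard A + ecard B"
  by (auto simp: ecard_def card_Plus)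

lemma ecard_less_than: "ecard {j. enat j < m} = m"
proof (cases m)
  case (enat n)
  then have "{j. enat j < m} = {..<n}"
    by auto
  then show ?thesis
    by (simp add: enat ecard_def)
next
  case infinity
  then show ?thesis
    by (simp add: ecard_def)
qed

lemma ecard_le_if_ordLeq:
  assumes "|A| \<le>o |B|"
  shows "ecard A \<le> ecard B"
proof -
  obtain f where f: "inj_on f A" "f ` A \<subseteq> B"
    using assms card_of_ordLeq [of A B] by auto
  have "ecard A = ecard (f ` A)"
    using f(1) by (simp add: ecard_image)
  also have "\<dots> \<le> ecard B"
    using f(2) by (rule ecard_mono)
  finally show ?thesis .
qed

text \<open>
  This is why \<open>enat\<close>-valued counts suffice throughout: the right-hand side is precisely the inequality
  of an \<open>\<omega>\<close>-unfriendly partition together with its exception for two infinite cardinals, so the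
  exception disappears once all infinite cardinals are identified.
\<close>
lemma ecard_le_iff:
  "ecard A \<le> ecard B \<longleftrightarrow> |A| \<le>o |B| \<or> natLeq \<le>o |A| \<and> natLeq \<le>o |B|"
    (is "_ \<longleftrightarrow> ?R")
proof
  assume le: "ecard A \<le> ecard B"
  consider "finite A" "finite B" | "finite A" "infinite B" | "infinite A" "infinite B"
    using le by (auto simp: ecard_def split: if_splits)
  then show ?R
  proof cases
    case 1
    then have "card A \<le> card B"
      using le by (simp add: ecard_def)
    then show ?thesis
      using 1 by (meson card_of_ordLeq inj_on_iff_card_le)
  next
    case 2
    then show ?thesis
      using card_of_ordLeq_finite [of B A] ordLeq_total [of "|A|" "|B|"]
      by (auto simp: card_of_Well_order)
  next
    case 3
    then show ?thesis
      using infinite_iff_natLeq_ordLeq [of A] infinite_iff_natLeq_ordLeq [of B] by simp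
  qed
next
  assume ?R
  then show "ecard A \<le> ecard B"
  proof
    assume "natLeq \<le>o |A| \<and> natLeq \<le>o |B|"
    then have "infinite B"
      using infinite_iff_natLeq_ordLeq [of B] by simp
    then show ?thesis
      by (simp add: ecard_def)
  qed (rule ecard_le_if_ordLeq)
qed

section \<open>Cores and countable graphs over an arbitrary type\<close>

text \<open>
  A core is the vertex set of a nonempty induced subgraph of infinite minimum degree.
\<close>
definition core :: "('a \<times> 'a) set \<Rightarrow> 'a set \<Rightarrow> bool" where
  "core r W \<longleftrightarrow> W \<noteq> {} \<and> (\<forall>x\<in>W. infinite (r `` {x} \<inter> W))"

lemma infinite_if_min_degree_infinite:
  assumes "cinfinite (min_degree W F)" "x \<in> W"
  shows "infinite (neighbours W F x)"
proof -
  have "min_degree W F \<le>o |neighbours W F x|"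
    using min_degree_minimum(2) [of W F] assms(2) unfolding degree_def by blast
  moreover have "Card_order (min_degree W F)"
    by (simp add: min_degree_def degree_def card_of_Card_order)
  ultimately have "cinfinite |neighbours W F x|"
    using assms(1) cinfinite_mono by blast
  then show ?thesis
    by (simp add: cinfinite_def Field_card_of)
qed

text \<open>
  A countable graph of any type embeds in every infinite type, so the size of the vertex type of the
  fourth property is immaterial, and the graph built below may live on a sum type.
\<close>
lemma transfer_unfriendly_colouring:
  fixes r :: "('x \<times> 'x) set"
  assumes four: "restricted_countable_graphs_unfriendly TYPE('d)"
    and inf: "infinite (UNIV :: 'd set)"
    and r: "sym r" "irrefl r" "countable (Field r)"
    and no_core: "\<And>W. \<not> core r W"
  obtains c :: "'x \<Rightarrow> bool"
    where "\<And>x. ecard {y. (x, y) \<in> r \<and> c y = c x} \<le> ecard {y. (x, y) \<in> r \<and> c y \<noteq> c x}"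
proof -
  obtain g :: "nat \<Rightarrow> 'd" where g: "inj g"
    using inf infinite_countable_subset by blast
  define f where "f = g \<circ> to_nat_on (Field r)"
  have f: "inj_on f (Field r)"
    unfolding f_def using r(3) g by (intro comp_inj_on) (auto intro: inj_on_subset)
  define V where "V = f ` Field r"
  define E where "E = {{f x, f y} |x y. (x, y) \<in> r}"
  have Field: "x \<in> Field r" "y \<in> Field r" if "(x, y) \<in> r" for x y
    using that by (auto intro: FieldI1 FieldI2)
  have E_iff: "{f x, f y} \<in> E \<longleftrightarrow> (x, y) \<in> r" if "x \<in> Field r" "y \<in> Field r" for x y
  proof
    assume "{f x, f y} \<in> E"
    then obtain u v where uv: "{f x, f y} = {f u, f v}" "(u, v) \<in> r"
      by (auto simp: E_def)
    from this(1) consider "f x = f u \<and> f y = f v" | "f x = f v \<and> f y = f u"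
      by (auto simp: doubleton_eq_iff)
    then show "(x, y) \<in> r"
      by cases (metis Field f inj_onD r(1) symD that uv(2))+
  qed (auto simp: E_def)
  have "is_graph V E"
    unfolding is_graph_def E_def V_def
    using Field f r(2) by (clarsimp simp: irrefl_def) (metis imageI inj_onD)
  moreover have "countable V"
    using r(3) by (simp add: V_def)
  moreover have False
    if ind: "induced_subgraph W F V E" and W: "W \<noteq> {}" "cinfinite (min_degree W F)" for W F
  proof -
    define W' where "W' = {x \<in> Field r. f x \<in> W}"
    have sub: "W \<subseteq> f ` Field r"
      using ind by (auto simp: induced_subgraph_def V_def)
    have "infinite (r `` {x} \<inter> W')" if "x \<in> W'" for x
    proof -
      have x: "f x \<in> W" "x \<in> Field r"
        using that by (auto simp: W'_def)
      have "neighbours W F (f x) \<subseteq> f ` (r `` {x} \<inter> W')"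
      proof
        fix z
        assume "z \<in> neighbours W F (f x)"
        then have z: "z \<in> W" "{f x, z} \<in> E"
          using ind by (auto simp: neighbours_def induced_subgraph_def)
        then obtain y where "y \<in> Field r" "z = f y"
          using sub by blast
        then show "z \<in> f ` (r `` {x} \<inter> W')"
          using z x E_iff by (auto simp: W'_def)
      qed
      moreover have "infinite (neighbours W F (f x))"
        using infinite_if_min_degree_infinite W(2) x(1) .
      ultimately show ?thesis
        by (meson finite_imageI finite_subset)
    qed
    moreover have "W' \<noteq> {}"
      using W(1) sub by (auto simp: W'_def)
    ultimately show False
      using no_core by (auto simp: core_def)
  qed
  ultimately obtain \<pi> where "unfriendly V E \<pi>"
    using four unfolding restricted_countable_graphs_unfriendly_def by blast
  then have \<pi>: "\<pi> \<in> V \<rightarrow> {0, 1}" and le: "\<And>x. x \<in> V \<Longrightarrow> d_eq V E \<pi> x \<le>o d_neq V E \<pi> x"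
    by (auto simp: unfriendly_def is_partition_def)
  define c where "c x \<longleftrightarrow> \<pi> (f x) = 1" for x
  have "ecard {y. (x, y) \<in> r \<and> c y = c x} \<le> ecard {y. (x, y) \<in> r \<and> c y \<noteq> c x}" for x
  proof (cases "x \<in> Field r")
    case True
    have colour: "\<pi> (f y) = \<pi> (f x) \<longleftrightarrow> c y = c x" if "y \<in> Field r" for y
    proof -
      have "\<pi> (f x) \<in> {0, 1}" "\<pi> (f y) \<in> {0, 1}"
        using \<pi> True that unfolding V_def by blast+
      then show ?thesis
        by (auto simp: c_def)
    qed
    have "{z \<in> V. {f x, z} \<in> E \<and> \<pi> z = \<pi> (f x)} = f ` {y. (x, y) \<in> r \<and> c y = c x}"
      "{z \<in> V. {f x, z} \<in> E \<and> \<pi> z \<noteq> \<pi> (f x)} = f ` {y. (x, y) \<in> r \<and> c y \<noteq> c x}"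
      unfolding V_def using E_iff [OF True] colour Field(2) by blast+
    moreover have "inj_on f {y. (x, y) \<in> r \<and> c y = c x}" "inj_on f {y. (x, y) \<in> r \<and> c y \<noteq> c x}"
      using f Field by (auto intro: inj_on_subset)
    moreover have "ecard {z \<in> V. {f x, z} \<in> E \<and> \<pi> z = \<pi> (f x)}
        \<le> ecard {z \<in> V. {f x, z} \<in> E \<and> \<pi> z \<noteq> \<pi> (f x)}"
      using le [of "f x"] True
      by (intro ecard_le_if_ordLeq) (auto simp: d_eq_def d_neq_def V_def)
    ultimately show ?thesis
      by (simp add: ecard_image)
  next
    case False
    then have "{y. (x, y) \<in> r \<and> c y = c x} = {}"
      using Field by blast
    then show ?thesis
      by (simp only: ecard_empty zero_le)
  qed
  then show thesis
    by (rule that)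
qed

section \<open>Simulating conditions by a rigid locally finite graph\<close>

text \<open>
  The rigid graph consists of finite layers \<open>0, 1, 2, \<dots>\<close>, consecutive layers being completely joined.
  Two features of the sizes matter: a vertex has an odd number of neighbours in the adjacent layers,
  so that these always have a strict majority colour, and layer \<open>n + 1\<close> is larger than layer \<open>n - 1\<close> by
  enough to outvote it together with the two vertices that attachments may spoil.
\<close>
definition layer_size :: "nat \<Rightarrow> nat" where
  "layer_size n = 5 * (n div 2 + 1)"

lemma layer_size_Suc_Suc: "layer_size (Suc (Suc n)) = layer_size n + 5"
  by (simp add: layer_size_def)

lemma layer_size_ge: "5 \<le> layer_size n"
  by (simp add: layer_size_def)

definition adjacent_layers :: "nat \<Rightarrow> (nat \<times> nat) set" where
  "adjacent_layers n = {(m, j). (m = Suc n \<or> n = Suc m) \<and> j < layer_size m}"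

lemma adjacent_layers_0: "adjacent_layers 0 = {Suc 0} \<times> {..<layer_size (Suc 0)}"
  by (auto simp: adjacent_layers_def)

lemma adjacent_layers_Suc:
  "adjacent_layers (Suc n) =
     {Suc (Suc n)} \<times> {..<layer_size (Suc (Suc n))} \<union> {n} \<times> {..<layer_size n}"
  by (auto simp: adjacent_layers_def)

lemma finite_adjacent_layers: "finite (adjacent_layers n)"
  by (cases n) (auto simp: adjacent_layers_0 adjacent_layers_Suc)

lemma card_adjacent_layers_Suc:
  "card (adjacent_layers (Suc n)) = layer_size (Suc (Suc n)) + layer_size n"
  unfolding adjacent_layers_Suc
  by (subst card_Un_disjoint) (auto simp: card_cartesian_product)

lemma odd_card_adjacent_layers: "odd (card (adjacent_layers n))"
proof (cases n)
  case 0
  then show ?thesis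
    by (simp add: adjacent_layers_0 card_cartesian_product layer_size_def)
next
  case (Suc m)
  then show ?thesis
    by (simp add: card_adjacent_layers_Suc layer_size_Suc_Suc)
qed

lemma card_adjacent_layers_less: "card (adjacent_layers n) + 3 < 2 * layer_size (Suc n)"
proof (cases n)
  case 0
  then show ?thesis
    by (simp add: adjacent_layers_0 card_cartesian_product layer_size_def)
next
  case (Suc m)
  then show ?thesis
    by (simp add: card_adjacent_layers_Suc layer_size_Suc_Suc)
qed

text \<open>
  Layer \<open>n\<close> will receive the colour given by the parity of \<open>n\<close>, up to a global swap. Hence a condition
  asking for \<open>k i x\<close> neighbours of colour \<open>i\<close> at \<open>x\<close> is met by attaching \<open>x\<close> to that many layers of the
  right parity. No layer may be used twice, because its vertices tolerate only one extra edge.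
\<close>
lemma ex_attachment:
  fixes k :: "bool \<Rightarrow> 'a \<Rightarrow> enat"
  assumes "countable S"
  obtains att :: "'a \<Rightarrow> nat set"
  where "disjoint_family_on att S"
    and "\<And>x i. ecard {n \<in> att x. odd n = i} = k i x"
proof -
  define code where "code x i j = 2 * prod_encode (to_nat_on S x, j) + of_bool i" for x i j
  have code_eq: "code x i j = code x' i' j' \<longleftrightarrow> to_nat_on S x = to_nat_on S x' \<and> i = i' \<and> j = j'"
    for x i j x' i' j'
    by (cases i; cases i') (auto simp: code_def, presburger+)
  have odd_code: "even (code x i j) = (\<not> i)" for x i j
    by (simp add: code_def)
  define att where "att x = {code x i j |i j. enat j < k i x}" for x
  have "{n \<in> att x. odd n = i} = code x i ` {j. enat j < k i x}" for x i
    by (auto simp: att_def odd_code)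
  moreover have "inj_on (code x i) {j. enat j < k i x}" for x i
    by (auto intro: inj_onI simp: code_eq)
  ultimately have "ecard {n \<in> att x. odd n = i} = k i x" for x i
    by (simp add: ecard_image ecard_less_than)
  moreover have "disjoint_family_on att S"
    using assms by (auto simp: disjoint_family_on_def att_def code_eq)
  ultimately show thesis
    using that by blast
qed

text \<open>
  The vertex \<open>Inr (n, i)\<close> is the \<open>i\<close>-th one of layer \<open>n\<close>; only the vertices with \<open>i = 0\<close> carry
  attachments.
\<close>
definition attached_graph ::
    "('a \<times> 'a) set \<Rightarrow> 'a set \<Rightarrow> ('a \<Rightarrow> nat set) \<Rightarrow> (('a + nat \<times> nat) \<times> ('a + nat \<times> nat)) set" where
  "attached_graph r S att =
     {(Inl x, Inl y) |x y. (x, y) \<in> r \<and> x \<in> S \<and> y \<in> S} \<union>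
     {(Inr (n, i), Inr p) |n i p. i < layer_size n \<and> p \<in> adjacent_layers n} \<union>
     {(Inl x, Inr (n, 0)) |x n. x \<in> S \<and> n \<in> att x} \<union>
     {(Inr (n, 0), Inl x) |x n. x \<in> S \<and> n \<in> att x}"

lemma attached_graph_simps [simp]:
  "(Inl x, Inl y) \<in> attached_graph r S att \<longleftrightarrow> (x, y) \<in> r \<and> x \<in> S \<and> y \<in> S"
  "(Inr (n, i), Inr p) \<in> attached_graph r S att \<longleftrightarrow> i < layer_size n \<and> p \<in> adjacent_layers n"
  "(Inl x, Inr (n, i)) \<in> attached_graph r S att \<longleftrightarrow> x \<in> S \<and> n \<in> att x \<and> i = 0"
  "(Inr (n, i), Inl x) \<in> attached_graph r S att \<longleftrightarrow> x \<in> S \<and> n \<in> att x \<and> i = 0"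
  by (auto simp: attached_graph_def) (metis surj_pair)

lemma sym_attached_graph:
  assumes "sym r"
  shows "sym (attached_graph r S att)"
proof (rule symI)
  fix v w
  assume "(v, w) \<in> attached_graph r S att"
  then show "(w, v) \<in> attached_graph r S att"
    using assms by (cases v; cases w) (auto simp: adjacent_layers_def dest: symD)
qed

lemma irrefl_attached_graph:
  assumes "irrefl r"
  shows "irrefl (attached_graph r S att)"
proof (rule irreflI)
  fix v
  show "(v, v) \<notin> attached_graph r S att"
    using assms by (cases v) (auto simp: adjacent_layers_def irrefl_def)
qed

lemma countable_Field_attached_graph:
  assumes "countable S"
  shows "countable (Field (attached_graph r S att))"
proof -
  have "Field (attached_graph r S att) \<subseteq> S <+> UNIV"
    by (auto simp: Field_def attached_graph_def)
  then show ?thesis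
    using assms by (meson countable_Plus countableI_type countable_subset)
qed

lemma layer_neighbours:
  assumes "disjoint_family_on att S"
  obtains T where "finite T" "card T \<le> Suc (card (adjacent_layers n))"
    "Inr ` adjacent_layers n \<subseteq> T"
    "attached_graph r S att `` {Inr (n, i)} \<subseteq> T"
proof -
  obtain X where X: "finite X" "card X \<le> 1" "{x \<in> S. n \<in> att x} \<subseteq> X"
  proof (cases "{x \<in> S. n \<in> att x} = {}")
    case True
    then show thesis
      using that [of "{}"] by simp
  next
    case False
    then obtain x where "x \<in> S" "n \<in> att x"
      by auto
    then have "{x \<in> S. n \<in> att x} \<subseteq> {x}"
      using assms by (auto simp: disjoint_family_on_def)
    then show thesis
      using that [of "{x}"] by simp
  qed
  show thesis
  proof
    show "finite (X <+> adjacent_layers n)"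
      using X(1) finite_adjacent_layers by (rule finite_Plus)
    show "card (X <+> adjacent_layers n) \<le> Suc (card (adjacent_layers n))"
      using X(1, 2) finite_adjacent_layers by (simp add: card_Plus)
    show "attached_graph r S att `` {Inr (n, i)} \<subseteq> X <+> adjacent_layers n"
    proof
      fix v
      assume "v \<in> attached_graph r S att `` {Inr (n, i)}"
      then show "v \<in> X <+> adjacent_layers n"
        using X(3) by (cases v) auto
    qed
  qed auto
qed

text \<open>
  The layers are locally finite, so attaching them creates no core, even when a vertex is attached to
  infinitely many of them.
\<close>
lemma core_attached_graph:
  assumes att: "disjoint_family_on att S"
    and core: "core (attached_graph r S att) W"
  obtains W' where "W' \<subseteq> S" "core r W'"
proof -
  have no_Inr: "Inr p \<notin> W" for p
  proof
    assume "Inr p \<in> W"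
    then have "infinite (attached_graph r S att `` {Inr p} \<inter> W)"
      using core by (auto simp: core_def)
    moreover obtain n i where "p = (n, i)"
      by fastforce
    moreover obtain T where "finite T" "attached_graph r S att `` {Inr (n, i)} \<subseteq> T"
      using att by (rule layer_neighbours)
    ultimately show False
      by (metis finite_Int finite_subset)
  qed
  define W' where "W' = Inl -` W"
  have W: "W = Inl ` W'"
  proof
    show "W \<subseteq> Inl ` W'"
    proof
      fix v
      assume "v \<in> W"
      then show "v \<in> Inl ` W'"
        using no_Inr by (cases v) (auto simp: W'_def)
    qed
  qed (auto simp: W'_def)
  have inf: "x \<in> S \<and> infinite (r `` {x} \<inter> W')" if "x \<in> W'" for x
  proof -
    have inf: "infinite (attached_graph r S att `` {Inl x} \<inter> W)"
      using core that by (auto simp: core_def W'_def)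
    moreover have sub: "attached_graph r S att `` {Inl x} \<inter> W \<subseteq>
        (if x \<in> S then Inl ` (r `` {x} \<inter> W') else {})"
      unfolding W by auto
    ultimately show ?thesis
      by (metis finite.emptyI finite_imageI finite_subset)
  qed
  show thesis
  proof
    show "W' \<subseteq> S"
      using inf by blast
    show "core r W'"
      using inf core W by (auto simp: core_def)
  qed
qed

text \<open>
  The rigidity of the layers. All vertices of layer \<open>n\<close> without attachment have the same odd number of
  neighbours, and the same ones, hence they all take the colour opposite to the majority colour there
  (\<open>inner\<close>). So layer \<open>n + 1\<close> is monochromatic except for one vertex, and its other vertices are
  more than half of the neighbours of any vertex of layer \<open>n\<close>, which must therefore be coloured
  opposite to them (\<open>layer\<close>).
  The colours are dictated from each layer to the preceding one, and thus alternate.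
\<close>
lemma layers_alternate:
  fixes r :: "('a \<times> 'a) set" and c :: "'a + nat \<times> nat \<Rightarrow> bool"
    and S :: "'a set" and att :: "'a \<Rightarrow> nat set"
  defines "G \<equiv> attached_graph r S att"
  assumes att: "disjoint_family_on att S"
    and c: "\<And>v. ecard {w. (v, w) \<in> G \<and> c w = c v} \<le> ecard {w. (v, w) \<in> G \<and> c w \<noteq> c v}"
  obtains b where "\<And>n. c (Inr (n, 0)) = (b \<noteq> odd n)"
proof -
  have card_le: "card {w. (Inr (n, i), w) \<in> G \<and> c w = c (Inr (n, i))}
      \<le> card {w. (Inr (n, i), w) \<in> G \<and> c w \<noteq> c (Inr (n, i))}" for n i
  proof -
    obtain T where T: "finite T" "attached_graph r S att `` {Inr (n, i)} \<subseteq> T"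
      using att by (rule layer_neighbours)
    have "finite {w. (Inr (n, i), w) \<in> G \<and> Q w}" for Q
      using T by (rule_tac finite_subset [of _ T]) (auto simp: G_def)
    then show ?thesis
      using c [of "Inr (n, i)"] by (simp add: ecard_def)
  qed
  \<comment> \<open>\<open>g n\<close> is the colour that is rarer in the layers adjacent to layer \<open>n\<close>.\<close>
  define M where "M n j = card {p \<in> adjacent_layers n. c (Inr p) = j}" for n j
  define g where "g n \<longleftrightarrow> M n True < M n False" for n
  have M_neq: "M n True \<noteq> M n False" for n
  proof -
    have "adjacent_layers n = {p \<in> adjacent_layers n. c (Inr p) = True} \<union>
        {p \<in> adjacent_layers n. c (Inr p) = False}"
      by auto
    then have "card (adjacent_layers n) = M n True + M n False"
      unfolding M_def using finite_adjacent_layers [of n]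
      by (subst card_Un_disjoint [symmetric]) auto
    then show ?thesis
      using odd_card_adjacent_layers [of n] by auto
  qed
  have inner: "c (Inr (n, i)) = g n" if "0 < i" "i < layer_size n" for n i
  proof -
    have "{w. (Inr (n, i), w) \<in> G \<and> Q w} = Inr ` {p \<in> adjacent_layers n. Q (Inr p)}" for Q
    proof -
      have "(Inr (n, i), w) \<in> G \<longleftrightarrow> w \<in> Inr ` adjacent_layers n" for w
        using that by (cases w) (auto simp: G_def)
      then show ?thesis
        by auto
    qed
    then have "M n (c (Inr (n, i))) \<le> M n (\<not> c (Inr (n, i)))"
      using card_le [of n i] by (simp add: card_image M_def)
    then show ?thesis
      using M_neq [of n] by (cases "c (Inr (n, i))") (auto simp: g_def)
  qed
  have layer: "c (Inr (n, i)) \<noteq> g (Suc n)" if "i < layer_size n" for n i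
  proof
    assume eq: "c (Inr (n, i)) = g (Suc n)"
    obtain T where T: "finite T" "card T \<le> Suc (card (adjacent_layers n))"
      "Inr ` adjacent_layers n \<subseteq> T" "G `` {Inr (n, i)} \<subseteq> T"
      unfolding G_def using att by (rule layer_neighbours)
    \<comment> \<open>the vertices of layer \<open>n + 1\<close> without attachment, which all have the colour \<open>g (Suc n)\<close>\<close>
    define I :: "('a + nat \<times> nat) set" where "I = Inr ` ({Suc n} \<times> {1..<layer_size (Suc n)})"
    have I: "I \<subseteq> Inr ` adjacent_layers n" "finite I" "card I = layer_size (Suc n) - 1"
      by (auto simp: I_def adjacent_layers_def card_image card_cartesian_product)
    have "I \<subseteq> {w. (Inr (n, i), w) \<in> G \<and> c w = c (Inr (n, i))}"
      using that eq inner by (auto simp: I_def G_def adjacent_layers_def)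
    moreover have "finite {w. (Inr (n, i), w) \<in> G \<and> c w = c (Inr (n, i))}"
      using T(1, 4) by (rule_tac finite_subset [of _ T]) auto
    ultimately have "card I \<le> card {w. (Inr (n, i), w) \<in> G \<and> c w = c (Inr (n, i))}"
      by (meson card_mono)
    also have "\<dots> \<le> card {w. (Inr (n, i), w) \<in> G \<and> c w \<noteq> c (Inr (n, i))}"
      by (rule card_le)
    also have "\<dots> \<le> card (T - I)"
      using T(1, 4) eq inner by (intro card_mono) (auto simp: I_def)
    also have "\<dots> = card T - card I"
      using I T by (intro card_Diff_subset) auto
    finally show False
      using I(3) T(2) card_adjacent_layers_less [of n] by linarith
  qed
  have g_Suc: "g (Suc n) = (\<not> g n)" for n
    using inner [of 1 n] layer [of 1 n] layer_size_ge [of n] by auto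
  have parity: "g n = (g 0 \<noteq> odd n)" for n
    by (induction n) (auto simp: g_Suc)
  have "c (Inr (n, 0)) = g n" for n
    using layer [of 0 n] g_Suc layer_size_ge [of n] by auto
  then have "c (Inr (n, 0)) = (g 0 \<noteq> odd n)" for n
    using parity [of n] by (rule trans)
  then show thesis
    by (rule that)
qed

text \<open>
  The fourth property implies its own strengthening to graphs with conditions. A colouring and its
  complement are equally good, so the global swap \<open>b\<close> left open by the rigid layers can be undone.
\<close>
lemma countable_conditioned_colouring:
  fixes r :: "('a \<times> 'a) set" and k :: "bool \<Rightarrow> 'a \<Rightarrow> enat"
  assumes four: "restricted_countable_graphs_unfriendly TYPE('d)"
    and inf: "infinite (UNIV :: 'd set)"
    and r: "sym r" "irrefl r"
    and S: "countable S" "\<And>W. W \<subseteq> S \<Longrightarrow> \<not> core r W"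
  shows "\<exists>c. \<forall>x\<in>S. k (c x) x + ecard {y \<in> S. (x, y) \<in> r \<and> c y = c x}
    \<le> k (\<not> c x) x + ecard {y \<in> S. (x, y) \<in> r \<and> c y \<noteq> c x}"
proof -
  obtain att :: "'a \<Rightarrow> nat set" where att: "disjoint_family_on att S"
    and att_k: "\<And>x i. ecard {n \<in> att x. odd n = i} = k i x"
    using ex_attachment [OF S(1), of k] by blast
  define G where "G = attached_graph r S att"
  have no_core: "\<not> core G W" for W
  proof
    assume "core G W"
    then obtain W' where "W' \<subseteq> S" "core r W'"
      unfolding G_def by (rule core_attached_graph [OF att])
    then show False
      using S(2) by blast
  qed
  have "sym G" "irrefl G" "countable (Field G)"
    unfolding G_def
    using r S(1) sym_attached_graph irrefl_attached_graph countable_Field_attached_graph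
    by blast+
  then obtain c :: "'a + nat \<times> nat \<Rightarrow> bool" where c: "\<And>v. ecard {w. (v, w) \<in> G \<and> c w = c v}
      \<le> ecard {w. (v, w) \<in> G \<and> c w \<noteq> c v}"
    using no_core by (rule transfer_unfriendly_colouring [OF four inf]) blast
  obtain b where b: "\<And>n. c (Inr (n, 0)) = (b \<noteq> odd n)"
    using layers_alternate [OF att c [unfolded G_def]] by metis
  have layer_colour: "(c (Inr (n, 0)) \<noteq> b) = odd n" for n
    using b [of n] by argo
  define d where "d x \<longleftrightarrow> c (Inl x) \<noteq> b" for x
  have count: "ecard {w. (Inl x, w) \<in> G \<and> (c w \<noteq> b) = i} =
      k i x + ecard {y \<in> S. (x, y) \<in> r \<and> d y = i}" if "x \<in> S" for x i
  proof -
    have split: "{w. (Inl x, w) \<in> G \<and> (c w \<noteq> b) = i} =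
        Inl ` {y \<in> S. (x, y) \<in> r \<and> d y = i} \<union> (\<lambda>n. Inr (n, 0)) ` {n \<in> att x. odd n = i}"
      (is "?L = ?R")
    proof (rule set_eqI)
      fix w
      show "w \<in> ?L \<longleftrightarrow> w \<in> ?R"
      proof (cases w)
        case (Inl y)
        show ?thesis
          unfolding Inl Un_iff inj_image_mem_iff [OF inj_Inl] using that
          by (simp add: G_def d_def conj_ac image_iff)
      next
        case (Inr p)
        obtain n j where p: "p = (n, j)"
          by fastforce
        have "Inr p \<in> ?L \<longleftrightarrow> n \<in> att x \<and> j = 0 \<and> (c (Inr (n, 0)) \<noteq> b) = i"
          using that by (auto simp: G_def p)
        also have "\<dots> \<longleftrightarrow> n \<in> att x \<and> j = 0 \<and> odd n = i"
          by (simp only: layer_colour)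
        also have "\<dots> \<longleftrightarrow> Inr p \<in> ?R"
          unfolding p by blast
        finally show ?thesis
          by (simp only: Inr)
      qed
    qed
    have "ecard (Inl ` {y \<in> S. (x, y) \<in> r \<and> d y = i} \<union>
          (\<lambda>n. Inr (n, 0) :: 'a + nat \<times> nat) ` {n \<in> att x. odd n = i}) =
        ecard {y \<in> S. (x, y) \<in> r \<and> d y = i} + ecard {n \<in> att x. odd n = i}"
      by (subst ecard_Un_disjoint) (auto simp: ecard_image inj_on_def)
    then show ?thesis
      by (simp only: split att_k add.commute)
  qed
  have "k (d x) x + ecard {y \<in> S. (x, y) \<in> r \<and> d y = d x}
      \<le> k (\<not> d x) x + ecard {y \<in> S. (x, y) \<in> r \<and> d y \<noteq> d x}" if "x \<in> S" for x
  proof -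
    have "{w. (Inl x, w) \<in> G \<and> c w = c (Inl x)} = {w. (Inl x, w) \<in> G \<and> (c w \<noteq> b) = d x}"
      "{w. (Inl x, w) \<in> G \<and> c w \<noteq> c (Inl x)} = {w. (Inl x, w) \<in> G \<and> (c w \<noteq> b) = (\<not> d x)}"
      "{y \<in> S. (x, y) \<in> r \<and> d y \<noteq> d x} = {y \<in> S. (x, y) \<in> r \<and> d y = (\<not> d x)}"
      by (auto simp: d_def)
    then show ?thesis
      using c [of "Inl x"] count [OF that] by simp
  qed
  then show ?thesis
    by blast
qed

section \<open>Splitting countable families and countable hulls\<close>

text \<open>
  Representatives \<open>z\<close> are chosen for the indices \<open>(i, b, n)\<close> one after the other, each in \<open>A i\<close> and
  different from its predecessors; the ones with \<open>b = True\<close> form \<open>B\<close>.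
\<close>
lemma common_splitting_set:
  fixes A :: "'i \<Rightarrow> 'a set"
  assumes "countable I" and inf: "\<And>i. i \<in> I \<Longrightarrow> infinite (A i)"
  obtains B where "\<And>i. i \<in> I \<Longrightarrow> infinite (A i \<inter> B)" "\<And>i. i \<in> I \<Longrightarrow> infinite (A i - B)"
proof -
  define N where "N = (\<lambda>(i, b::bool, n::nat). A i)"
  define J where "J = I \<times> (UNIV :: (bool \<times> nat) set)"
  have "countable J"
    using assms(1) by (simp add: J_def)
  define e where "e = to_nat_on J"
  have e: "inj_on e J"
    unfolding e_def using \<open>countable J\<close> by (rule inj_on_to_nat_on)
  have "\<exists>z :: nat \<Rightarrow> 'a. \<forall>m. (\<forall>j\<in>J. e j = m \<longrightarrow> z m \<in> N j - z ` {..<m})"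
  proof (rule dependent_wellorder_choice, goal_cases)
    case (1 r f g m)
    then have "f ` {..<m} = g ` {..<m}"
      by (auto simp: image_iff)
    then show ?case
      by simp
  next
    case (2 m f)
    show ?case
    proof (cases "m \<in> e ` J")
      case True
      then obtain j where j: "j \<in> J" "m = e j"
        by auto
      then have "infinite (N j - f ` {..<m})"
        using inf by (auto simp: J_def N_def)
      then obtain y where "y \<in> N j - f ` {..<m}"
        using infinite_imp_nonempty by blast
      then show ?thesis
        using j e by (auto dest: inj_onD)
    qed auto
  qed
  then obtain z where z_def: "\<And>m. \<forall>j\<in>J. e j = m \<longrightarrow> z m \<in> N j - z ` {..<m}"
    by blast
  have z: "z (e j) \<in> N j" if "j \<in> J" for j
    using z_def [of "e j"] that by auto
  have fresh: "z m \<noteq> z (e j)" if "j \<in> J" "m < e j" for j m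
    using z_def [of "e j"] that by (metis DiffE imageI lessThan_iff)
  have inj: "inj_on (\<lambda>j. z (e j)) J"
    using e fresh by (intro inj_onI) (metis inj_onD linorder_neqE_nat)
  define B where "B = {z (e (i, True, n)) |i n. i \<in> I}"
  have "infinite ((\<lambda>n. z (e (i, b, n))) ` UNIV)" if "i \<in> I" for i b
  proof
    assume "finite ((\<lambda>n. z (e (i, b, n))) ` UNIV)"
    moreover have "inj (\<lambda>n. z (e (i, b, n)))"
      using inj that by (auto simp: J_def inj_on_def)
    ultimately show False
      using finite_imageD by blast
  qed
  moreover have "(\<lambda>n. z (e (i, True, n))) ` UNIV \<subseteq> A i \<inter> B" if "i \<in> I" for i
    using z [of "(i, True, _)"] that by (auto simp: B_def J_def N_def)
  moreover have "z (e (i, False, n)) \<notin> B" if "i \<in> I" for i n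
  proof
    assume "z (e (i, False, n)) \<in> B"
    then obtain i' n' where "z (e (i, False, n)) = z (e (i', True, n'))" "i' \<in> I"
      by (auto simp: B_def)
    then have "(i, False, n) = (i', True, n')"
      using that by (intro inj_onD [OF inj]) (auto simp: J_def)
    then show False
      by simp
  qed
  then have "(\<lambda>n. z (e (i, False, n))) ` UNIV \<subseteq> A i - B" if "i \<in> I" for i
    using z [of "(i, False, _)"] that by (auto simp: J_def N_def)
  ultimately show thesis
    using that [of B] by (meson finite_subset)
qed

text \<open>
  A countable set that retains, for each of its vertices, either the whole neighbourhood in \<open>R\<close> or
  infinitely many neighbours, is obtained by iterating a countable choice of neighbours. In the first
  case a colouring of the set decides the fate of the vertex. In the second case an unfriendly
  colouring provides infinitely many neighbours of the other colour, and later choices are harmless.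
\<close>
lemma countable_hull:
  fixes r :: "('a \<times> 'a) set"
  assumes "x0 \<in> R"
  obtains S where "countable S" "S \<subseteq> R" "x0 \<in> S"
    "\<And>x. x \<in> S \<Longrightarrow> infinite (r `` {x} \<inter> S) \<or> r `` {x} \<inter> R \<subseteq> S"
proof -
  have "\<exists>F. F \<subseteq> r `` {x} \<inter> R \<and> countable F \<and> (infinite F \<or> F = r `` {x} \<inter> R)" for x
  proof (cases "finite (r `` {x} \<inter> R)")
    case True
    then show ?thesis
      using countable_finite by blast
  next
    case False
    then show ?thesis
      using infinite_countable_subset' by metis
  qed
  then obtain F where F: "\<And>x. F x \<subseteq> r `` {x} \<inter> R" "\<And>x. countable (F x)"
    "\<And>x. infinite (F x) \<or> F x = r `` {x} \<inter> R"
    by metis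
  define S where "S = {(x, y). y \<in> F x}\<^sup>* `` {x0}"
  have "countable ({(x, y). y \<in> F x} `` Y)" if "countable Y" for Y
  proof -
    have "{(x, y). y \<in> F x} `` Y = (\<Union>x\<in>Y. F x)"
      by auto
    then show ?thesis
      using F(2) that by simp
  qed
  then have "countable S"
    unfolding S_def by (intro countable_rtrancl) auto
  moreover have "S \<subseteq> R"
  proof
    fix y
    assume "y \<in> S"
    then have "(x0, y) \<in> {(x, y). y \<in> F x}\<^sup>*"
      by (simp add: S_def)
    then show "y \<in> R"
      using assms F(1) by induction auto
  qed
  moreover have "F x \<subseteq> S" if "x \<in> S" for x
    using that by (auto simp: S_def intro: rtrancl_into_rtrancl)
  then have "infinite (r `` {x} \<inter> S) \<or> r `` {x} \<inter> R \<subseteq> S" if "x \<in> S" for x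
    using that F(1, 3) [of x] by (metis Int_greatest finite_subset le_infE)
  ultimately show thesis
    by (intro that [of S]) (auto simp: S_def)
qed

section \<open>Maximal settled partial colourings\<close>

definition cond_count ::
    "(bool \<Rightarrow> 'a \<Rightarrow> enat) \<Rightarrow> ('a \<times> 'a) set \<Rightarrow> ('a \<times> bool) set \<Rightarrow> bool \<Rightarrow> 'a \<Rightarrow> enat" where
  "cond_count k r P i x = k i x + ecard {y. (x, y) \<in> r \<and> (y, i) \<in> P}"

text \<open>
  A vertex is settled with the colour \<open>i\<close> by a partial colouring when no extension can disturb it:
  either the other colour already occurs infinitely often, or all neighbours have been coloured
  and the inequality holds.
\<close>
definition settled ::
    "(bool \<Rightarrow> 'a \<Rightarrow> enat) \<Rightarrow> ('a \<times> 'a) set \<Rightarrow> ('a \<times> bool) set \<Rightarrow> 'a \<Rightarrow> bool \<Rightarrow> bool" where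
  "settled k r P x i \<longleftrightarrow>
     cond_count k r P (\<not> i) x = \<infinity> \<or>
     r `` {x} \<subseteq> Domain P \<and> cond_count k r P i x \<le> cond_count k r P (\<not> i) x"

lemma cond_count_mono: "P \<subseteq> Q \<Longrightarrow> cond_count k r P i x \<le> cond_count k r Q i x"
  unfolding cond_count_def by (intro add_left_mono ecard_mono) auto

lemma settled_mono:
  assumes "settled k r P x i" "P \<subseteq> Q" "single_valued Q"
  shows "settled k r Q x i"
proof (cases "cond_count k r P (\<not> i) x = \<infinity>")
  case True
  then show ?thesis
    using cond_count_mono [OF assms(2), of k r "\<not> i" x] by (simp add: settled_def)
next
  case False
  then have P: "r `` {x} \<subseteq> Domain P" "cond_count k r P i x \<le> cond_count k r P (\<not> i) x"
    using assms(1) by (auto simp: settled_def)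
  have "(y, j) \<in> P \<longleftrightarrow> (y, j) \<in> Q" if "(x, y) \<in> r" for y j
  proof
    assume "(y, j) \<in> Q"
    moreover obtain j' where "(y, j') \<in> P"
      using P(1) \<open>(x, y) \<in> r\<close> by blast
    ultimately show "(y, j) \<in> P"
      using assms(2, 3) by (metis single_valuedD subsetD)
  qed (use assms(2) in blast)
  then have "cond_count k r Q j x = cond_count k r P j x" for j
    unfolding cond_count_def by (metis (no_types, lifting))
  moreover have "r `` {x} \<subseteq> Domain Q"
    using P(1) assms(2) by (meson Domain_mono order_trans)
  ultimately show ?thesis
    using P(2) by (simp add: settled_def)
qed

definition admissible ::
    "(bool \<Rightarrow> 'a \<Rightarrow> enat) \<Rightarrow> ('a \<times> 'a) set \<Rightarrow> ('a \<times> bool) set \<Rightarrow> bool" where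
  "admissible k r P \<longleftrightarrow> single_valued P \<and> (\<forall>(x, i)\<in>P. settled k r P x i)"

lemma admissible_Union_chain:
  assumes "subset.chain {P. admissible k r P} C"
  shows "admissible k r (\<Union>C)"
proof -
  have adm: "admissible k r P" if "P \<in> C" for P
    using assms that by (auto simp: subset.chain_def)
  have "single_valued (\<Union>C)"
  proof (rule single_valuedI)
    fix x i j
    assume "(x, i) \<in> \<Union>C" "(x, j) \<in> \<Union>C"
    then obtain P Q where "P \<in> C" "Q \<in> C" "(x, i) \<in> P" "(x, j) \<in> Q"
      by blast
    moreover from this have "P \<subseteq> Q \<or> Q \<subseteq> P"
      using assms by (auto simp: subset.chain_def)
    moreover have "single_valued P" "single_valued Q"
      using adm \<open>P \<in> C\<close> \<open>Q \<in> C\<close> by (auto simp: admissible_def)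
    ultimately show "i = j"
      by (metis single_valuedD subsetD)
  qed
  moreover from this have "settled k r (\<Union>C) x i" if "(x, i) \<in> P" "P \<in> C" for x i P
    using adm [OF that(2)] that by (auto simp: admissible_def intro: settled_mono)
  ultimately show ?thesis
    by (auto simp: admissible_def)
qed

lemma admissible_extension:
  assumes P: "admissible k r P" and S: "S \<inter> Domain P = {}"
    and new: "\<And>x. x \<in> S \<Longrightarrow> settled k r (P \<union> {(y, c y) |y. y \<in> S}) x (c x)"
  shows "admissible k r (P \<union> {(y, c y) |y. y \<in> S})" (is "admissible k r ?Q")
proof -
  have "single_valued ?Q"
    using P S by (auto simp: admissible_def single_valued_def)
  then show ?thesis
    using P new by (auto simp: admissible_def intro: settled_mono [of k r P])
qed

lemma cond_count_extension:
  assumes "S \<inter> Domain P = {}"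
  shows "cond_count k r (P \<union> {(y, c y) |y. y \<in> S}) i x =
    cond_count k r P i x + ecard {y \<in> S. (x, y) \<in> r \<and> c y = i}"
proof -
  have "{y. (x, y) \<in> r \<and> (y, i) \<in> P \<union> {(y, c y) |y. y \<in> S}} =
      {y. (x, y) \<in> r \<and> (y, i) \<in> P} \<union> {y \<in> S. (x, y) \<in> r \<and> c y = i}"
    by auto
  moreover have "{y. (x, y) \<in> r \<and> (y, i) \<in> P} \<inter> {y \<in> S. (x, y) \<in> r \<and> c y = i} = {}"
    using assms by auto
  ultimately show ?thesis
    by (simp add: cond_count_def ecard_Un_disjoint add.assoc)
qed

text \<open>
  Any graph with conditions can be coloured as soon as its countable sets of vertices without cores
  can, whatever the conditions. In a maximal partial colouring with all coloured vertices settled, let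
  \<open>S\<close> be a countable hull of an uncoloured vertex. If \<open>S\<close> contains a core, a common splitting set of the
  neighbourhoods colours the core so that every vertex has infinitely many neighbours of each colour.
  Otherwise \<open>S\<close> can be coloured, with the neighbours coloured so far counted as conditions. Either way the
  partial colouring extends, so it was total.
\<close>
lemma unfriendly_colouring_if_countable:
  fixes r :: "('a \<times> 'a) set"
  assumes countable: "\<And>S (k :: bool \<Rightarrow> 'a \<Rightarrow> enat).
      countable S \<Longrightarrow> (\<And>W. W \<subseteq> S \<Longrightarrow> \<not> core r W) \<Longrightarrow>
      \<exists>c :: 'a \<Rightarrow> bool. \<forall>x\<in>S.
        k (c x) x + ecard {y \<in> S. (x, y) \<in> r \<and> c y = c x}
          \<le> k (\<not> c x) x + ecard {y \<in> S. (x, y) \<in> r \<and> c y \<noteq> c x}"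
  obtains c where "\<And>x. k (c x) x + ecard {y. (x, y) \<in> r \<and> c y = c x}
      \<le> k (\<not> c x) x + ecard {y. (x, y) \<in> r \<and> c y \<noteq> c x}"
proof -
  have "\<exists>P\<in>{P. admissible k r P}. \<forall>Q\<in>{P. admissible k r P}. P \<subseteq> Q \<longrightarrow> Q = P"
    by (rule subset_Zorn') (use admissible_Union_chain in blast)
  then obtain P where P: "admissible k r P"
    and max: "\<And>Q. admissible k r Q \<Longrightarrow> P \<subseteq> Q \<Longrightarrow> Q = P"
    by blast
  have no_extension: "\<exists>x\<in>S. \<not> settled k r (P \<union> {(y, c y) |y. y \<in> S}) x (c x)"
    if "S \<inter> Domain P = {}" "S \<noteq> {}" for S c
    using max [OF admissible_extension [OF P that(1), of c]] that by blast
  have total: "Domain P = UNIV"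
  proof (rule ccontr)
    assume "Domain P \<noteq> UNIV"
    then obtain x0 where "x0 \<in> - Domain P"
      by blast
    then obtain S where S: "countable S" "S \<subseteq> - Domain P" "x0 \<in> S"
      and closed: "\<And>x. x \<in> S \<Longrightarrow> infinite (r `` {x} \<inter> S) \<or> r `` {x} \<inter> - Domain P \<subseteq> S"
      by (rule countable_hull [of _ _ r]) blast
    show False
    proof (cases "\<exists>W\<subseteq>S. core r W")
      case True
      then obtain W where W: "W \<subseteq> S" "W \<noteq> {}" "\<And>x. x \<in> W \<Longrightarrow> infinite (r `` {x} \<inter> W)"
        by (auto simp: core_def)
      have "countable W"
        using W(1) S(1) by (rule countable_subset)
      then obtain B where B: "\<And>x. x \<in> W \<Longrightarrow> infinite (r `` {x} \<inter> W \<inter> B)"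
        "\<And>x. x \<in> W \<Longrightarrow> infinite (r `` {x} \<inter> W - B)"
        using W(3) by (rule common_splitting_set [of W "\<lambda>x. r `` {x} \<inter> W"]) blast+
      define c where "c x \<longleftrightarrow> x \<in> B" for x
      have disj: "W \<inter> Domain P = {}"
        using W(1) S(2) by auto
      have "infinite {y \<in> W. (x, y) \<in> r \<and> c y = i}" if "x \<in> W" for x i
      proof -
        have "{y \<in> W. (x, y) \<in> r \<and> c y = i} =
            (if i then r `` {x} \<inter> W \<inter> B else r `` {x} \<inter> W - B)"
          by (auto simp: c_def)
        then show ?thesis
          using B that by simp
      qed
      then have "cond_count k r (P \<union> {(y, c y) |y. y \<in> W}) (\<not> c x) x = \<infinity>" if "x \<in> W" for x
        unfolding cond_count_extension [OF disj] using that by (simp add: plus_eq_infty_iff_enat)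
      then have "settled k r (P \<union> {(y, c y) |y. y \<in> W}) x (c x)" if "x \<in> W" for x
        using that by (simp add: settled_def)
      then show False
        using no_extension W(2) disj by blast
    next
      case False
      obtain c where c: "\<And>x. x \<in> S \<Longrightarrow>
          cond_count k r P (c x) x + ecard {y \<in> S. (x, y) \<in> r \<and> c y = c x}
            \<le> cond_count k r P (\<not> c x) x + ecard {y \<in> S. (x, y) \<in> r \<and> c y \<noteq> c x}"
        using countable [of S "cond_count k r P"] S(1) False by blast
      let ?Q = "P \<union> {(y, c y) |y. y \<in> S}"
      have disj: "S \<inter> Domain P = {}"
        using S(2) by auto
      have "settled k r ?Q x (c x)" if "x \<in> S" for x
      proof (cases "cond_count k r ?Q (\<not> c x) x = \<infinity>")
        case False
        \<comment> \<open>Then both counts are finite, so the hull contains all uncoloured neighbours of \<open>x\<close>.\<close>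
        have le: "cond_count k r ?Q (c x) x \<le> cond_count k r ?Q (\<not> c x) x"
          using c [OF that] by (simp add: cond_count_extension disj)
        have "cond_count k r ?Q (c x) x \<noteq> \<infinity>"
        proof
          assume "cond_count k r ?Q (c x) x = \<infinity>"
          with le have "\<infinity> \<le> cond_count k r ?Q (\<not> c x) x"
            by (rule subst [rotated])
          with False show False
            by simp
        qed
        with False have "cond_count k r ?Q j x \<noteq> \<infinity>" for j
          by (cases "j = c x") auto
        then have fin: "finite {y \<in> S. (x, y) \<in> r \<and> c y = j}" for j
          by (auto simp: cond_count_extension disj plus_eq_infty_iff_enat)
        have split: "r `` {x} \<inter> S =
            {y \<in> S. (x, y) \<in> r \<and> c y = True} \<union> {y \<in> S. (x, y) \<in> r \<and> c y = False}"
          by auto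
        have "finite (r `` {x} \<inter> S)"
          unfolding split by (intro finite_UnI fin)
        then have "r `` {x} \<subseteq> Domain ?Q"
          using closed [OF that] by auto
        then show ?thesis
          using le by (simp add: settled_def)
      qed (simp add: settled_def)
      then show False
        using no_extension [OF disj] S(3) by blast
    qed
  qed
  define c where "c x \<longleftrightarrow> (x, True) \<in> P" for x
  have c: "(x, i) \<in> P \<longleftrightarrow> c x = i" for x i
    using total P by (cases i) (auto simp: c_def admissible_def single_valued_def, (metis Domain.cases UNIV_I)+)
  have "cond_count k r P (c x) x \<le> cond_count k r P (\<not> c x) x" for x
    using P c [of x "c x"] by (auto simp: admissible_def settled_def)
  then show thesis
    by (intro that [of c]) (simp add: cond_count_def c)
qed

section \<open>The equivalences\<close>

text \<open>
  The colour \<open>True\<close> stands for the value \<open>1\<close>, and a condition enters only through the number of its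
  elements.
\<close>
lemma conditioned_if_restricted:
  assumes four: "restricted_countable_graphs_unfriendly TYPE('d)"
    and inf: "infinite (UNIV :: 'd set)"
  shows "conditioned_graphs_omega_unfriendly TYPE('a) TYPE('k)"
  unfolding conditioned_graphs_omega_unfriendly_def
proof (intro allI impI)
  fix V :: "'a set" and E and \<kappa> \<nu> :: "'a \<Rightarrow> 'k rel"
  assume "is_conditioned_graph V E \<kappa> \<nu>"
  then have edge: "x \<in> V \<and> y \<in> V \<and> x \<noteq> y" if "{x, y} \<in> E" for x y
    using that unfolding is_conditioned_graph_def is_graph_def
    by (fastforce simp: doubleton_eq_iff)
  define r where "r = {(x, y). {x, y} \<in> E}"
  have "(x, x) \<notin> r" for x
    using edge [of x x] by (auto simp: r_def)
  then have r: "sym r" "irrefl r"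
    by (auto simp: r_def sym_def irrefl_def insert_commute)
  define k where "k i x = ecard (Field (if i then \<nu> x else \<kappa> x))" for i :: bool and x
  obtain c where c: "\<And>x. k (c x) x + ecard {y. (x, y) \<in> r \<and> c y = c x}
      \<le> k (\<not> c x) x + ecard {y. (x, y) \<in> r \<and> c y \<noteq> c x}"
    using countable_conditioned_colouring [OF four inf r]
    by (rule unfriendly_colouring_if_countable [of r k]) blast+
  define \<pi> where "\<pi> x = (of_bool (c x) :: nat)" for x
  define N where "N i x = {y \<in> V. {x, y} \<in> E \<and> \<pi> y = i}" for i x
  have N: "N (of_bool i) x = {y. (x, y) \<in> r \<and> c y = i}" for i x
    using edge by (auto simp: N_def r_def \<pi>_def)
  define A where "A i x = Field (if i then \<nu> x else \<kappa> x) <+> N (of_bool i) x" for i x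
  have le: "ecard (A (c x) x) \<le> ecard (A (\<not> c x) x)" for x
    using c [of x] by (simp add: A_def ecard_Plus N k_def)
  have degrees: "cond_degree V E \<kappa> \<pi> 0 x = |A False x|" "cond_degree V E \<nu> \<pi> 1 x = |A True x|" for x
    by (simp_all add: cond_degree_def csum_def A_def N_def Field_card_of)
  have "(\<pi> x = 0 \<longrightarrow> cond_degree V E \<kappa> \<pi> 0 x \<le>o cond_degree V E \<nu> \<pi> 1 x) \<and>
      (\<pi> x = 1 \<longrightarrow> cond_degree V E \<nu> \<pi> 1 x \<le>o cond_degree V E \<kappa> \<pi> 0 x) \<or>
      natLeq \<le>o cond_degree V E \<kappa> \<pi> 0 x \<and> natLeq \<le>o cond_degree V E \<nu> \<pi> 1 x" for x
    using le [of x] unfolding ecard_le_iff degrees by (cases "c x") (auto simp: \<pi>_def)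
  then have "cond_unfriendly natLeq V E \<kappa> \<nu> \<pi>"
    by (auto simp: cond_unfriendly_def is_partition_def Let_def \<pi>_def of_bool_def)
  then show "\<exists>\<pi>. cond_unfriendly natLeq V E \<kappa> \<nu> \<pi>"
    by blast
qed

lemma omega_unfriendly_if_conditioned:
  assumes "conditioned_graphs_omega_unfriendly TYPE('a) TYPE('k)"
  shows "graphs_omega_unfriendly TYPE('a)"
  unfolding graphs_omega_unfriendly_def
proof (intro allI impI)
  fix V :: "'a set" and E
  assume "is_graph V E"
  \<comment> \<open>the cardinal \<open>0\<close>, which exists over every type\<close>
  define \<kappa> where "\<kappa> = (\<lambda>_ :: 'a. |{} :: 'k set| )"
  have "is_conditioned_graph V E \<kappa> \<kappa>"
    using \<open>is_graph V E\<close> by (simp add: is_conditioned_graph_def \<kappa>_def card_of_Card_order)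
  then obtain \<pi> where \<pi>: "cond_unfriendly natLeq V E \<kappa> \<kappa> \<pi>"
    using assms unfolding conditioned_graphs_omega_unfriendly_def by blast
  define N where "N i x = {y \<in> V. {x, y} \<in> E \<and> \<pi> y = i}" for i x
  have degree: "cond_degree V E \<kappa> \<pi> i x = |Inr ` N i x :: ('k + 'a) set|" for i x
    by (simp add: cond_degree_def csum_def \<kappa>_def Field_card_of Plus_def N_def)
  have part: "\<pi> \<in> V \<rightarrow> {0, 1}"
    using \<pi> by (simp add: cond_unfriendly_def is_partition_def)
  have "ecard (N (\<pi> x) x) \<le> ecard (N (1 - \<pi> x) x)" if "x \<in> V" for x
  proof -
    have "\<pi> x = 0 \<or> \<pi> x = 1"
      using part that by auto
    moreover have "ecard (Inr ` N i x :: ('k + 'a) set) = ecard (N i x)" for i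
      by (simp add: ecard_image)
    ultimately show ?thesis
      using \<pi> that ecard_le_iff [of "Inr ` N (\<pi> x) x :: ('k + 'a) set"
          "Inr ` N (1 - \<pi> x) x :: ('k + 'a) set"]
      by (auto simp: cond_unfriendly_def degree Let_def)
  qed
  moreover have "d_eq V E \<pi> x = |N (\<pi> x) x|" "d_neq V E \<pi> x = |N (1 - \<pi> x) x|" if "x \<in> V" for x
  proof -
    have "\<pi> y \<noteq> \<pi> x \<longleftrightarrow> \<pi> y = 1 - \<pi> x" if "y \<in> V" for y
    proof -
      have "\<pi> x = 0 \<or> \<pi> x = 1" "\<pi> y = 0 \<or> \<pi> y = 1"
        using part \<open>x \<in> V\<close> \<open>y \<in> V\<close> by auto
      then show ?thesis
        by (elim disjE) simp_all
    qed
    then show "d_eq V E \<pi> x = |N (\<pi> x) x|" "d_neq V E \<pi> x = |N (1 - \<pi> x) x|"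
      by (auto simp: d_eq_def d_neq_def N_def intro!: arg_cong [where f = card_of])
  qed
  ultimately have "card_unfriendly natLeq V E \<pi>"
    using part by (auto simp: card_unfriendly_def is_partition_def ecard_le_iff)
  then show "\<exists>\<pi>. card_unfriendly natLeq V E \<pi>"
    by blast
qed

lemma countable_unfriendly_if_omega_unfriendly:
  assumes "graphs_omega_unfriendly TYPE('a)"
  shows "countable_graphs_unfriendly TYPE('a)"
  unfolding countable_graphs_unfriendly_def
proof (intro allI impI)
  fix V :: "'a set" and E
  assume V: "is_graph V E \<and> countable V"
  then obtain \<pi> where \<pi>: "card_unfriendly natLeq V E \<pi>"
    using assms unfolding graphs_omega_unfriendly_def by blast
  have "d_eq V E \<pi> x \<le>o natLeq" for x
    using V unfolding d_eq_def countable_card_le_natLeq [symmetric] by (auto intro: countable_subset)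
  then have "unfriendly V E \<pi>"
    using \<pi> by (auto simp: unfriendly_def card_unfriendly_def intro: ordLeq_transitive)
  then show "\<exists>\<pi>. unfriendly V E \<pi>"
    by blast
qed

lemma restricted_if_countable_unfriendly:
  "countable_graphs_unfriendly TYPE('a) \<Longrightarrow> restricted_countable_graphs_unfriendly TYPE('a)"
  unfolding countable_graphs_unfriendly_def restricted_countable_graphs_unfriendly_def by blast

(* Each property has its own vertex type, so every "each graph" ranges over infinite types of
   any cardinality, independently of the others; on a finite type the properties would only
   speak about finite graphs. *)
theorem mainTheorem3:
  assumes "infinite (UNIV :: 'a set)"
    and "infinite (UNIV :: 'b set)"
    and "infinite (UNIV :: 'c set)"
    and "infinite (UNIV :: 'd set)"
  shows "(conditioned_graphs_omega_unfriendly TYPE('a) TYPE('k) \<longleftrightarrow>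
            graphs_omega_unfriendly TYPE('b)) \<and>
         (graphs_omega_unfriendly TYPE('b) \<longleftrightarrow>
            countable_graphs_unfriendly TYPE('c)) \<and>
         (countable_graphs_unfriendly TYPE('c) \<longleftrightarrow>
            restricted_countable_graphs_unfriendly TYPE('d))"
  by (meson assms omega_unfriendly_if_conditioned countable_unfriendly_if_omega_unfriendly
      restricted_if_countable_unfriendly conditioned_if_restricted)

end
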